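(* Assume $u_1,u_2,u_3\in C^2$, $p\in C^1$ and $F_1,F_2,F_3\in C^1$ (on $K_1'$). Then the Navier–Stokes equations $$\frac{\partial u_1}{\partial x_1}+\frac{\partial u_2}{\partial x_2}+\frac{\partial u_3}{\partial x_3}=0,\qquad \frac{\partial u_j}{\partial t}-\mu\Delta u_j+\sum_{k=1}^3u_k\frac{\partial u_j}{\partial x_k}+\tau\frac{\partial p}{\partial x_j}=F_j,\quad j=1,2,3,$$ can be converted into the following simultaneous system, for an unknown $55$-dimensional vector $Z$ of functions of $(t,x_1,x_2,x_3)$, of first order linear partial differential equations with constant coefficients $$\frac{\partial(HZ+h)}{\partial t}=H_0Z+h_0,\qquad \frac{\partial(HZ+h)}{\partial x_i}=H_iZ,\quad i=1,2,3,$$ and quadratic equations $$\begin{aligned} &e_{47}^TZ=(e_3^TZ)(-\alpha_1^TZ),\quad e_{48}^TZ=(e_7^TZ)(e_1^TZ),\quad e_{49}^TZ=(e_{11}^TZ)(e_2^TZ),\\ &e_{50}^TZ=(e_3^TZ)(e_4^TZ),\quad e_{51}^TZ=(e_7^TZ)(e_5^TZ),\quad e_{52}^TZ=(e_{11}^TZ)(e_6^TZ),\\ &e_{53}^TZ=(e_3^TZ)(e_8^TZ),\quad e_{54}^TZ=(e_7^TZ)(e_9^TZ),\quad e_{55}^TZ=(e_{11}^TZ)(e_{10}^TZ). \end{aligned}$$ That is: every solution $(u_1,u_2,u_3,p)$ of the Navier–Stokes equations arises as $(u_1,u_2,u_3,p)^T=(e_3,e_7,e_{11},e_{16})^TZ$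 for some $Z$ satisfying this system, and, for $Z$ satisfying this system, $(u_1,u_2,u_3,p)^T=(e_3,e_7,e_{11},e_{16})^TZ$ is a solution of the Navier–Stokes equations.
   Context: $\mu$ (dynamic viscosity) and $\tau=1/\rho$ (specific volume, $\rho$ the density) are positive constants. $u=(u_1,u_2,u_3)$ is the velocity, $p$ the pressure, $F=(F_1,F_2,F_3)$ the body force; all are real functions of $(t,x_1,x_2,x_3)$. Standing assumptions: $T>0$ is given, $K_1\subset\mathbb{R}^3$ is bounded and closed, $K_1'=[0,T]\times K_1$; the equations are considered on $K_1'$, and $u_j,p,F_j$ vanish identically for $(t,x)\notin K_1'$; $u_j\in C^2$, $p\in C^1$, $F_j\in C^1$ on $K_1'$; and $\partial K_1$ satisfies the exterior ball condition (for every $x\in\partial K_1$ there is a closed ball $B_\rho(y)$ of radius $\rho>0$ contained in $\mathbb{R}^3\setminus K_1^0$, with $K_1^0$ the interior of $K_1$, such that $B_\rho(y)\cap K_1=\{x\}$). Notation: $e_i$ ($1\le i\le55$) is the $i$-th unit coordinate (column) vector of $\mathbb{R}^{55}$; $0_n$ denotes a row of $n$ zeros. The column vectors $\alpha_i\in\mathbb{R}^{55}$ are $$\alpha_1=e_5+e_{10},\quad \alpha_2=\tau e_{13}-\mu(e_{18}+e_{19}+e_{20})+e_{47}+e_{48}+e_{49},$$ $$\alpha_3=\tau e_{14}-\mu(e_{28}+e_{29}+e_{30})+e_{50}+e_{51}+e_{52},\quad \alpha_4=\tau e_{15}-\mu(e_{38}+e_{39}+e_{40})+e_{53}+e_{54}+e_{55}.$$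 The $16\times55$ matrices $H,H_0,H_1,H_2,H_3$ (transposes of the matrices with the listed columns) are $$H=(-\alpha_1,-\alpha_2,-\alpha_3,-\alpha_4,e_1,e_2,e_3,e_4,e_5,e_6,e_7,e_8,e_9,e_{10},e_{11},e_{16})^T,$$ $$H_0=(e_{21},e_{17},e_{27},e_{37},e_{22},e_{23},-\alpha_2,e_{31},e_{32},e_{33},-\alpha_3,e_{41},e_{42},e_{43},-\alpha_4,e_{12})^T,$$ $$H_1=(e_{18},e_{21},e_{31},e_{41},e_{24},e_{25},-\alpha_1,e_{28},e_{34},e_{35},e_4,e_{38},e_{44},e_{45},e_8,e_{13})^T,$$ $$H_2=(e_{24},e_{22},e_{32},e_{42},e_{19},e_{26},e_1,e_{34},e_{29},e_{36},e_5,e_{44},e_{39},e_{46},e_9,e_{14})^T,$$ $$H_3=(e_{25},e_{23},e_{33},e_{43},e_{26},e_{20},e_2,e_{35},e_{36},e_{30},e_6,e_{45},e_{46},e_{40},e_{10},e_{15})^T,$$ and $h=(0,F_1,F_2,F_3,0_{12})^T$, $h_0=(0_6,F_1,0_3,F_2,0_3,F_3,0)^T$ are $16$-dimensional. The assumption $u_j\in C^2$, $p\in C^1$ is in force throughout, i.e. in the converse direction the functions $e_3^TZ,e_7^TZ,e_{11}^TZ$ are understood to be $C^2$ and $e_{16}^TZ$ to be $C^1$. *)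

theory Defs
  imports "HOL-Analysis.Analysis"
begin

type_synonym spacetime = "real \<times> (real^3)"

definition dir_t :: spacetime where
  "dir_t = (1, 0)"

definition dir_x :: "3 \<Rightarrow> spacetime" where
  "dir_x k = (0, axis k 1)"

text \<open>
  On a closed set \<open>K\<close>, the partial derivative of \<open>f\<close> in the coordinate direction \<open>v\<close> is the
  classical one at interior points of \<open>K\<close>, and its continuous extension from the interior
  at the remaining points of \<open>K\<close> (as in the usual definition of \<open>C\<^sup>k\<close> up to the boundary).
  The values of \<open>f\<close> outside \<open>K\<close> are irrelevant, so functions that are extended by zero may
  jump across the boundary.
\<close>

definition partial_deriv_on ::
    "'a::euclidean_space set \<Rightarrow> 'a \<Rightarrow> ('a \<Rightarrow> real) \<Rightarrow> ('a \<Rightarrow> real) \<Rightarrow> bool" where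
  "partial_deriv_on K v f g \<longleftrightarrow>
     (\<forall>z\<in>interior K. ((\<lambda>s. f (z + s *\<^sub>R v)) has_real_derivative g z) (at 0)) \<and>
     (\<forall>z\<in>K - interior K. (g \<longlongrightarrow> g z) (at z within interior K))"

primrec Ck_on :: "nat \<Rightarrow> 'a::euclidean_space set \<Rightarrow> ('a \<Rightarrow> real) \<Rightarrow> bool" where
  "Ck_on 0 K f \<longleftrightarrow> continuous_on K f"
| "Ck_on (Suc k) K f \<longleftrightarrow>
     continuous_on K f \<and> (\<forall>v\<in>Basis. \<exists>g. partial_deriv_on K v f g \<and> Ck_on k K g)"

definition exterior_ball_condition :: "'a::euclidean_space set \<Rightarrow> bool" where
  "exterior_ball_condition K \<longleftrightarrow>
     (\<forall>x\<in>frontier K. \<exists>y r. r > 0 \<and> cball y r \<subseteq> - interior K \<and> cball y r \<inter> K = {x})"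

text \<open>Standing regularity and support assumptions on the unknowns \<open>(u, p)\<close> and on \<open>F\<close>.\<close>

definition admissible_flow ::
    "spacetime set \<Rightarrow> (spacetime \<Rightarrow> real^3) \<Rightarrow> (spacetime \<Rightarrow> real) \<Rightarrow> bool" where
  "admissible_flow K u p \<longleftrightarrow>
     (\<forall>j. Ck_on 2 K (\<lambda>z. u z $ j)) \<and> Ck_on 1 K p \<and> (\<forall>z. z \<notin> K \<longrightarrow> u z = 0 \<and> p z = 0)"

definition admissible_force :: "spacetime set \<Rightarrow> (spacetime \<Rightarrow> real^3) \<Rightarrow> bool" where
  "admissible_force K F \<longleftrightarrow>
     (\<forall>j. Ck_on 1 K (\<lambda>z. F z $ j)) \<and> (\<forall>z. z \<notin> K \<longrightarrow> F z = 0)"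

text \<open>
  The derivative fields occurring in the equations are bound existentially:
  \<open>ut j\<close> is \<open>\<partial>u\<^sub>j/\<partial>t\<close>, \<open>ux j k\<close> is \<open>\<partial>u\<^sub>j/\<partial>x\<^sub>k\<close>, \<open>uxx j k\<close> is \<open>\<partial>\<^sup>2u\<^sub>j/\<partial>x\<^sub>k\<^sup>2\<close>, \<open>px k\<close> is \<open>\<partial>p/\<partial>x\<^sub>k\<close>.
  They are uniquely determined on the closure of the interior of \<open>K\<close>.
\<close>

definition navier_stokes ::
    "spacetime set \<Rightarrow> real \<Rightarrow> real \<Rightarrow> (spacetime \<Rightarrow> real^3) \<Rightarrow>
     (spacetime \<Rightarrow> real^3) \<Rightarrow> (spacetime \<Rightarrow> real) \<Rightarrow> bool" where
  "navier_stokes K \<mu> \<tau> F u p \<longleftrightarrow>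
     (\<exists>(ut :: 3 \<Rightarrow> spacetime \<Rightarrow> real) (ux :: 3 \<Rightarrow> 3 \<Rightarrow> spacetime \<Rightarrow> real)
       (uxx :: 3 \<Rightarrow> 3 \<Rightarrow> spacetime \<Rightarrow> real) (px :: 3 \<Rightarrow> spacetime \<Rightarrow> real).
       (\<forall>j. partial_deriv_on K dir_t (\<lambda>z. u z $ j) (ut j)) \<and>
       (\<forall>j k. partial_deriv_on K (dir_x k) (\<lambda>z. u z $ j) (ux j k)) \<and>
       (\<forall>j k. partial_deriv_on K (dir_x k) (ux j k) (uxx j k)) \<and>
       (\<forall>k. partial_deriv_on K (dir_x k) p (px k)) \<and>
       (\<forall>z\<in>K. (\<Sum>k\<in>UNIV. ux k k z) = 0) \<and>
       (\<forall>z\<in>K. \<forall>j. ut j z - \<mu> * (\<Sum>k\<in>UNIV. uxx j k z) + (\<Sum>k\<in>UNIV. u z $ k * ux j k z)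
                     + \<tau> * px j z = F z $ j))"

text \<open>
  Components are numbered from 1. In the index types \<open>55\<close>, \<open>16\<close> and \<open>3\<close> numerals are read
  modulo the size, so the last index is the numeral \<open>55\<close> (\<open>16\<close>, \<open>3\<close>), which equals \<open>0\<close>.
\<close>

definition e :: "55 \<Rightarrow> real^55" where
  "e i = axis i 1"

definition alpha1 :: "real^55" where
  "alpha1 = e 5 + e 10"

definition alpha2 :: "real \<Rightarrow> real \<Rightarrow> real^55" where
  "alpha2 \<mu> \<tau> = \<tau> *\<^sub>R e 13 - \<mu> *\<^sub>R (e 18 + e 19 + e 20) + e 47 + e 48 + e 49"

definition alpha3 :: "real \<Rightarrow> real \<Rightarrow> real^55" where
  "alpha3 \<mu> \<tau> = \<tau> *\<^sub>R e 14 - \<mu> *\<^sub>R (e 28 + e 29 + e 30) + e 50 + e 51 + e 52"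

definition alpha4 :: "real \<Rightarrow> real \<Rightarrow> real^55" where
  "alpha4 \<mu> \<tau> = \<tau> *\<^sub>R e 15 - \<mu> *\<^sub>R (e 38 + e 39 + e 40) + e 53 + e 54 + e 55"

text \<open>The vectors listed are the rows of the matrices.\<close>

definition matH :: "real \<Rightarrow> real \<Rightarrow> real^55^16" where
  "matH \<mu> \<tau> = vector
     [- alpha1, - alpha2 \<mu> \<tau>, - alpha3 \<mu> \<tau>, - alpha4 \<mu> \<tau>, e 1, e 2, e 3, e 4,
      e 5, e 6, e 7, e 8, e 9, e 10, e 11, e 16]"

definition matH0 :: "real \<Rightarrow> real \<Rightarrow> real^55^16" where
  "matH0 \<mu> \<tau> = vector
     [e 21, e 17, e 27, e 37, e 22, e 23, - alpha2 \<mu> \<tau>, e 31,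
      e 32, e 33, - alpha3 \<mu> \<tau>, e 41, e 42, e 43, - alpha4 \<mu> \<tau>, e 12]"

definition matH1 :: "real^55^16" where
  "matH1 = vector
     [e 18, e 21, e 31, e 41, e 24, e 25, - alpha1, e 28,
      e 34, e 35, e 4, e 38, e 44, e 45, e 8, e 13]"

definition matH2 :: "real^55^16" where
  "matH2 = vector
     [e 24, e 22, e 32, e 42, e 19, e 26, e 1, e 34,
      e 29, e 36, e 5, e 44, e 39, e 46, e 9, e 14]"

definition matH3 :: "real^55^16" where
  "matH3 = vector
     [e 25, e 23, e 33, e 43, e 26, e 20, e 2, e 35,
      e 36, e 30, e 6, e 45, e 46, e 40, e 10, e 15]"

definition vec_h :: "real^3 \<Rightarrow> real^16" where
  "vec_h f = vector [0, f $ 1, f $ 2, f $ 3, 0, 0, 0, 0, 0, 0, 0, 0, 0, 0, 0, 0]"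

definition vec_h0 :: "real^3 \<Rightarrow> real^16" where
  "vec_h0 f = vector [0, 0, 0, 0, 0, 0, f $ 1, 0, 0, 0, f $ 2, 0, 0, 0, f $ 3, 0]"

definition linear_system ::
    "spacetime set \<Rightarrow> real \<Rightarrow> real \<Rightarrow> (spacetime \<Rightarrow> real^3) \<Rightarrow> (spacetime \<Rightarrow> real^55) \<Rightarrow> bool" where
  "linear_system K \<mu> \<tau> F Z \<longleftrightarrow>
     (\<forall>r. let W = (\<lambda>z. (matH \<mu> \<tau> *v Z z + vec_h (F z)) $ r) in
        partial_deriv_on K dir_t W (\<lambda>z. (matH0 \<mu> \<tau> *v Z z + vec_h0 (F z)) $ r) \<and>
        partial_deriv_on K (dir_x 1) W (\<lambda>z. (matH1 *v Z z) $ r) \<and>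
        partial_deriv_on K (dir_x 2) W (\<lambda>z. (matH2 *v Z z) $ r) \<and>
        partial_deriv_on K (dir_x 3) W (\<lambda>z. (matH3 *v Z z) $ r))"

definition quadratic_equations :: "spacetime set \<Rightarrow> (spacetime \<Rightarrow> real^55) \<Rightarrow> bool" where
  "quadratic_equations K Z \<longleftrightarrow> (\<forall>z\<in>K.
     e 47 \<bullet> Z z = (e 3 \<bullet> Z z) * (- alpha1 \<bullet> Z z) \<and>
     e 48 \<bullet> Z z = (e 7 \<bullet> Z z) * (e 1 \<bullet> Z z) \<and>
     e 49 \<bullet> Z z = (e 11 \<bullet> Z z) * (e 2 \<bullet> Z z) \<and>
     e 50 \<bullet> Z z = (e 3 \<bullet> Z z) * (e 4 \<bullet> Z z) \<and>
     e 51 \<bullet> Z z = (e 7 \<bullet> Z z) * (e 5 \<bullet> Z z) \<and>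
     e 52 \<bullet> Z z = (e 11 \<bullet> Z z) * (e 6 \<bullet> Z z) \<and>
     e 53 \<bullet> Z z = (e 3 \<bullet> Z z) * (e 8 \<bullet> Z z) \<and>
     e 54 \<bullet> Z z = (e 7 \<bullet> Z z) * (e 9 \<bullet> Z z) \<and>
     e 55 \<bullet> Z z = (e 11 \<bullet> Z z) * (e 10 \<bullet> Z z))"

definition velocity_of :: "(spacetime \<Rightarrow> real^55) \<Rightarrow> spacetime \<Rightarrow> real^3" where
  "velocity_of Z z = vector [e 3 \<bullet> Z z, e 7 \<bullet> Z z, e 11 \<bullet> Z z]"

definition pressure_of :: "(spacetime \<Rightarrow> real^55) \<Rightarrow> spacetime \<Rightarrow> real" where
  "pressure_of Z z = e 16 \<bullet> Z z"

end

theory Submission imports Defs begin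

text \<open>
  The vector \<open>Z\<close> collects the velocity, the pressure, their partial derivatives (second order
  for \<open>u\<close>, first order for \<open>p\<close>) and the nine products \<open>u\<^sub>k \<partial>u\<^sub>j/\<partial>x\<^sub>k\<close>, with \<open>\<partial>u\<^sub>1/\<partial>x\<^sub>1\<close> and the
  \<open>\<partial>u\<^sub>j/\<partial>t\<close> eliminated by means of the incompressibility and momentum equations; these appear as
  \<open>-\<alpha>\<^sub>1\<^sup>TZ\<close> and \<open>F\<^sub>j - \<alpha>\<^sub>j\<^sub>+\<^sub>1\<^sup>TZ\<close>. The linear system says that the sixteen entries of \<open>HZ + h\<close>,
  namely \<open>p\<close>, the \<open>u\<^sub>j\<close> and the first derivatives of the \<open>u\<^sub>j\<close>, have the entries of \<open>Z\<close> as
  derivatives; its consistency is the symmetry of the second derivatives.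
\<close>

section \<open>Coordinates of vectors given by long lists\<close>

lemma UNIV_16: "(UNIV :: 16 set) = {1,2,3,4,5,6,7,8,9,10,11,12,13,14,15,16}"
  by (rule card_subset_eq[symmetric]) auto

lemma forall_16: "(\<forall>r::16. P r) \<longleftrightarrow> P 1 \<and> P 2 \<and> P 3 \<and> P 4 \<and> P 5 \<and> P 6 \<and> P 7 \<and> P 8 \<and>
    P 9 \<and> P 10 \<and> P 11 \<and> P 12 \<and> P 13 \<and> P 14 \<and> P 15 \<and> P 16"
proof -
  have "(\<forall>r::16. P r) \<longleftrightarrow> (\<forall>r\<in>UNIV. P r)" by simp
  then show ?thesis unfolding UNIV_16 by simp
qed

lemma e_inner [simp]: "e i \<bullet> x = x $ i"
  by (simp add: e_def inner_axis')

lemma matrix_vector_row: "(A *v x) $ r = A $ r \<bullet> (x::real^'n)"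
  by (simp add: matrix_vector_mult_def inner_vec_def)

text \<open>The fold of function updates behind \<open>vector\<close>, restated as a recursion that
  \<open>simp\<close> can evaluate. With a start at 1 the counter wraps at the size of the index
  type, so a full list has its last component at numeral 16 or 55, which equals 0 there.\<close>

primrec entry :: "'a list \<Rightarrow> 'n \<Rightarrow> 'n::{plus,one} \<Rightarrow> 'a::zero" where
  "entry [] n i = 0"
| "entry (x # xs) n i = (if i = n then x else entry xs (n + 1) i)"

lemma vector_entry: "vector l $ i = entry l 1 i"
proof -
  have "foldr (\<lambda>x f n. (f (n + 1))(n := x)) l (\<lambda>n x. 0) n i = entry l n i" for n
    by (induction l arbitrary: n) auto
  then show ?thesis by (simp add: vector_def)
qed

text \<open>The equation is a premise so that \<open>vector_16[OF matH_def]\<close> turns a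
  definition directly into rewrite rules for its rows.\<close>

lemma vector_16:
  assumes "w = (vector [a1,a2,a3,a4,a5,a6,a7,a8,a9,a10,a11,a12,a13,a14,a15,a16] :: 'a::zero^16)"
  shows "w $ 1 = a1" "w $ 2 = a2" "w $ 3 = a3" "w $ 4 = a4" "w $ 5 = a5" "w $ 6 = a6"
    "w $ 7 = a7" "w $ 8 = a8" "w $ 9 = a9" "w $ 10 = a10" "w $ 11 = a11" "w $ 12 = a12"
    "w $ 13 = a13" "w $ 14 = a14" "w $ 15 = a15" "w $ 16 = a16"
  by (simp_all add: assms vector_entry)

lemma vector_55:
  assumes "w = (vector [a1, a2, a3, a4, a5, a6, a7, a8, a9, a10, a11, a12, a13, a14, a15, a16,
      a17, a18, a19, a20, a21, a22, a23, a24, a25, a26, a27, a28, a29, a30, a31, a32, a33, a34, a35, a36, a37,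
      a38, a39, a40, a41, a42, a43, a44, a45, a46, a47, a48, a49, a50, a51, a52, a53, a54, a55]
      :: 'a::zero^55)"
  shows "w $ 1 = a1" "w $ 2 = a2" "w $ 3 = a3" "w $ 4 = a4" "w $ 5 = a5" "w $ 6 = a6" "w $ 7 = a7"
    "w $ 8 = a8" "w $ 9 = a9" "w $ 10 = a10" "w $ 11 = a11" "w $ 12 = a12" "w $ 13 = a13"
    "w $ 14 = a14" "w $ 15 = a15" "w $ 16 = a16" "w $ 17 = a17" "w $ 18 = a18" "w $ 19 = a19"
    "w $ 20 = a20" "w $ 21 = a21" "w $ 22 = a22" "w $ 23 = a23" "w $ 24 = a24" "w $ 25 = a25"
    "w $ 26 = a26" "w $ 27 = a27" "w $ 28 = a28" "w $ 29 = a29" "w $ 30 = a30" "w $ 31 = a31"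
    "w $ 32 = a32" "w $ 33 = a33" "w $ 34 = a34" "w $ 35 = a35" "w $ 36 = a36" "w $ 37 = a37"
    "w $ 38 = a38" "w $ 39 = a39" "w $ 40 = a40" "w $ 41 = a41" "w $ 42 = a42" "w $ 43 = a43"
    "w $ 44 = a44" "w $ 45 = a45" "w $ 46 = a46" "w $ 47 = a47" "w $ 48 = a48" "w $ 49 = a49"
    "w $ 50 = a50" "w $ 51 = a51" "w $ 52 = a52" "w $ 53 = a53" "w $ 54 = a54" "w $ 55 = a55"
  by (simp_all add: assms vector_entry)

section \<open>Symmetry of second derivatives\<close>

text \<open>Schwarz's theorem for two directions: the second difference of \<open>f\<close> over a
  small parallelogram is symmetric in \<open>v\<close> and \<open>w\<close>, and two applications of
  the mean value theorem express it through either mixed derivative near \<open>z\<close>.\<close>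

lemma mixed_partials_commute:
  fixes f :: "'a::real_normed_vector \<Rightarrow> real"
  assumes U: "open U" and z: "z \<in> U"
    and v: "\<And>x. x \<in> U \<Longrightarrow> ((\<lambda>s. f (x + s *\<^sub>R v)) has_real_derivative fv x) (at 0)"
    and w: "\<And>x. x \<in> U \<Longrightarrow> ((\<lambda>s. f (x + s *\<^sub>R w)) has_real_derivative fw x) (at 0)"
    and vw: "\<And>x. x \<in> U \<Longrightarrow> ((\<lambda>s. fv (x + s *\<^sub>R w)) has_real_derivative fvw x) (at 0)"
    and wv: "\<And>x. x \<in> U \<Longrightarrow> ((\<lambda>s. fw (x + s *\<^sub>R v)) has_real_derivative fwv x) (at 0)"
    and cont: "isCont fvw z" "isCont fwv z"
  shows "fvw z = fwv z"
proof -
  \<comment> \<open>A derivative at parameter 0 for every base point in \<open>U\<close> is a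
    derivative at every parameter along a line, as the mean value theorem requires.\<close>
  have shift: "((\<lambda>s. g (x + s *\<^sub>R b)) has_real_derivative g' (x + s *\<^sub>R b)) (at s)"
    if "\<And>y. y \<in> U \<Longrightarrow> ((\<lambda>s. g (y + s *\<^sub>R b)) has_real_derivative g' y) (at 0)"
      and "x + s *\<^sub>R b \<in> U" for g g' :: "'a \<Rightarrow> real" and x b s
  proof -
    have "((\<lambda>r. g ((x + s *\<^sub>R b) + r *\<^sub>R b)) has_real_derivative g' (x + s *\<^sub>R b)) (at 0)"
      using that by blast
    then show ?thesis
      using DERIV_at_within_shift[of "\<lambda>s. g (x + s *\<^sub>R b)" "g' (x + s *\<^sub>R b)" s 0 UNIV]
      by (simp add: algebra_simps)
  qed
  \<comment> \<open>First the mean value theorem in direction \<open>p\<close> for the increment of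
    \<open>g\<close> under \<open>h *\<^sub>R q\<close>, then in direction \<open>q\<close> for
    \<open>gp\<close> at the point found.\<close>
  have second_difference: "\<exists>a b. 0 < a \<and> a < h \<and> 0 < b \<and> b < h \<and>
      g (z + h *\<^sub>R p + h *\<^sub>R q) - g (z + h *\<^sub>R p) - g (z + h *\<^sub>R q) + g z
        = h * h * gpq (z + a *\<^sub>R p + b *\<^sub>R q)"
    if h: "0 < h"
      and gp: "\<And>y. y \<in> U \<Longrightarrow> ((\<lambda>s. g (y + s *\<^sub>R p)) has_real_derivative gp y) (at 0)"
      and gpq: "\<And>y. y \<in> U \<Longrightarrow> ((\<lambda>s. gp (y + s *\<^sub>R q)) has_real_derivative gpq y) (at 0)"
      and inU: "\<And>a b. 0 \<le> a \<Longrightarrow> a \<le> h \<Longrightarrow> 0 \<le> b \<Longrightarrow> b \<le> h \<Longrightarrow> z + a *\<^sub>R p + b *\<^sub>R q \<in> U"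
    for g gp gpq :: "'a \<Rightarrow> real" and p q h
  proof -
    let ?\<phi> = "\<lambda>s. g ((z + h *\<^sub>R q) + s *\<^sub>R p) - g (z + s *\<^sub>R p)"
    let ?\<phi>' = "\<lambda>s. gp ((z + h *\<^sub>R q) + s *\<^sub>R p) - gp (z + s *\<^sub>R p)"
    have "(?\<phi> has_real_derivative ?\<phi>' s) (at s)" if "0 \<le> s" "s \<le> h" for s
    proof -
      have "(z + h *\<^sub>R q) + s *\<^sub>R p \<in> U" "z + s *\<^sub>R p \<in> U"
        using inU[of s h] inU[of s 0] h that by (simp_all add: algebra_simps)
      then show ?thesis by (intro DERIV_diff shift[OF gp])
    qed
    from MVT2[of 0 h ?\<phi> ?\<phi>', OF h this] obtain a where a: "0 < a" "a < h"
      and 1: "?\<phi> h - ?\<phi> 0 = h * (gp ((z + h *\<^sub>R q) + a *\<^sub>R p) - gp (z + a *\<^sub>R p))"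
      by auto
    let ?\<psi> = "\<lambda>s. gp ((z + a *\<^sub>R p) + s *\<^sub>R q)"
    let ?\<psi>' = "\<lambda>s. gpq ((z + a *\<^sub>R p) + s *\<^sub>R q)"
    have "(?\<psi> has_real_derivative ?\<psi>' s) (at s)" if "0 \<le> s" "s \<le> h" for s
      using shift[OF gpq inU] a that by simp
    from MVT2[of 0 h ?\<psi> ?\<psi>', OF h this] obtain b where b: "0 < b" "b < h"
      and 2: "?\<psi> h - ?\<psi> 0 = h * ?\<psi>' b"
      by auto
    have "g (z + h *\<^sub>R p + h *\<^sub>R q) - g (z + h *\<^sub>R p) - g (z + h *\<^sub>R q) + g z = ?\<phi> h - ?\<phi> 0"
      by (simp add: add.commute add.left_commute)
    also have "\<dots> = h * (?\<psi> h - ?\<psi> 0)"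
      unfolding 1 by (simp add: add.commute add.left_commute)
    also have "\<dots> = h * h * gpq (z + a *\<^sub>R p + b *\<^sub>R q)"
      unfolding 2 by simp
    finally show ?thesis using a b by blast
  qed
  have "dist (fvw z) (fwv z) \<le> \<epsilon>" if "\<epsilon> > 0" for \<epsilon>
  proof -
    have "\<forall>\<^sub>F x in nhds z. x \<in> U \<and> dist (fvw x) (fvw z) < \<epsilon>/2 \<and> dist (fwv x) (fwv z) < \<epsilon>/2"
      using that cont z U unfolding isCont_def tendsto_at_iff_tendsto_nhds
      by (intro eventually_conj eventually_nhds_in_open tendstoD) simp_all
    then obtain d where d: "d > 0" and near: "\<And>x. dist x z < d \<Longrightarrow>
        x \<in> U \<and> dist (fvw x) (fvw z) < \<epsilon>/2 \<and> dist (fwv x) (fwv z) < \<epsilon>/2"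
      unfolding eventually_nhds_metric by blast
    \<comment> \<open>The summand 1 keeps the denominator positive when \<open>v\<close> and
      \<open>w\<close> vanish; the factor 2 makes the bound by \<open>d\<close> strict.\<close>
    define h where "h = d / (2 * (norm v + norm w + 1))"
    have h: "h > 0" using d by (simp add: h_def add_nonneg_pos)
    have hd: "h * (norm v + norm w) < d"
    proof -
      have "h * (norm v + norm w) \<le> h * (norm v + norm w + 1)"
        using h by (simp add: algebra_simps)
      also have "\<dots> = d / 2"
        using add_nonneg_pos[of "norm v + norm w" 1] by (simp add: h_def field_simps)
      finally show ?thesis using d by simp
    qed
    have close: "dist (z + a *\<^sub>R v + b *\<^sub>R w) z < d"
      if "0 \<le> a" "a \<le> h" "0 \<le> b" "b \<le> h" for a b
    proof -
      have "norm (a *\<^sub>R v + b *\<^sub>R w) \<le> a * norm v + b * norm w"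
        using that norm_triangle_ineq[of "a *\<^sub>R v" "b *\<^sub>R w"] by simp
      also have "\<dots> \<le> h * norm v + h * norm w"
        using that by (intro add_mono mult_right_mono) auto
      finally show ?thesis using hd by (simp add: dist_norm algebra_simps)
    qed
    have inU: "z + a *\<^sub>R v + b *\<^sub>R w \<in> U" if "0 \<le> a" "a \<le> h" "0 \<le> b" "b \<le> h" for a b
      using near[OF close[OF that]] by blast
    obtain a b where ab: "0 < a" "a < h" "0 < b" "b < h"
      and 1: "f (z + h *\<^sub>R v + h *\<^sub>R w) - f (z + h *\<^sub>R v) - f (z + h *\<^sub>R w) + f z
        = h * h * fvw (z + a *\<^sub>R v + b *\<^sub>R w)"
      using second_difference[OF h v vw inU] by blast
    have inU': "z + a *\<^sub>R w + b *\<^sub>R v \<in> U" if "0 \<le> a" "a \<le> h" "0 \<le> b" "b \<le> h" for a b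
      using inU[of b a] that by (simp add: algebra_simps)
    obtain a' b' where ab': "0 < a'" "a' < h" "0 < b'" "b' < h"
      and 2: "f (z + h *\<^sub>R w + h *\<^sub>R v) - f (z + h *\<^sub>R w) - f (z + h *\<^sub>R v) + f z
        = h * h * fwv (z + a' *\<^sub>R w + b' *\<^sub>R v)"
      using second_difference[OF h w wv inU'] by blast
    \<comment> \<open>Both sides are the same second difference, so the mixed derivatives agree at
      two possibly different points, each close to \<open>z\<close>.\<close>
    have "h * h * fvw (z + a *\<^sub>R v + b *\<^sub>R w) = h * h * fwv (z + b' *\<^sub>R v + a' *\<^sub>R w)"
      unfolding 1[symmetric] using 2 by (simp add: algebra_simps)
    then have eq: "fvw (z + a *\<^sub>R v + b *\<^sub>R w) = fwv (z + b' *\<^sub>R v + a' *\<^sub>R w)"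
      using h by simp
    have "dist (fvw (z + a *\<^sub>R v + b *\<^sub>R w)) (fvw z) < \<epsilon>/2"
      using near[OF close[of a b]] ab by simp
    moreover have "dist (fwv (z + b' *\<^sub>R v + a' *\<^sub>R w)) (fwv z) < \<epsilon>/2"
      using near[OF close[of b' a']] ab' by simp
    ultimately show ?thesis
      unfolding eq by (rule less_imp_le[OF dist_triangle_half_r])
  qed
  then have "dist (fvw z) (fwv z) \<le> 0"
    by (rule field_le_epsilon) simp
  then show ?thesis by simp
qed

section \<open>Partial derivatives on a closed set\<close>

text \<open>The interior is open, so a short segment through \<open>z\<close> stays inside it and
  the derivative sees only values there.\<close>

lemma partial_deriv_interior_cong:
  assumes "partial_deriv_on K v f g" and "z \<in> interior K"
    and "\<And>z. z \<in> interior K \<Longrightarrow> f' z = f z"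
  shows "((\<lambda>s. f' (z + s *\<^sub>R v)) has_real_derivative g z) (at 0)"
proof -
  have "open ((\<lambda>s. z + s *\<^sub>R v) -` interior K)"
    by (intro open_vimage open_interior continuous_intros)
  then have "\<forall>\<^sub>F s in nhds 0. z + s *\<^sub>R v \<in> interior K"
    using assms(2) eventually_nhds_in_open[of _ 0] by fastforce
  then have "\<forall>\<^sub>F s in nhds 0. f' (z + s *\<^sub>R v) = f (z + s *\<^sub>R v)"
    by (rule eventually_mono) (rule assms(3))
  then show ?thesis
    using assms(1,2) unfolding partial_deriv_on_def
    by (subst DERIV_cong_ev[OF refl _ refl]) auto
qed

text \<open>Allows functions to be exchanged when they agree on the interior only: at the remaining
  points the required limit of \<open>g'\<close> follows from its continuity on
  \<open>K\<close>.\<close>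

lemma partial_deriv_onI:
  assumes "partial_deriv_on K v f g" and "continuous_on K g'"
    and "\<And>z. z \<in> interior K \<Longrightarrow> f' z = f z" and "\<And>z. z \<in> interior K \<Longrightarrow> g' z = g z"
  shows "partial_deriv_on K v f' g'"
  unfolding partial_deriv_on_def
proof (intro conjI ballI)
  fix z assume z: "z \<in> interior K"
  show "((\<lambda>s. f' (z + s *\<^sub>R v)) has_real_derivative g' z) (at 0)"
    unfolding assms(4)[OF z] by (rule partial_deriv_interior_cong[OF assms(1) z assms(3)])
next
  fix z assume "z \<in> K - interior K"
  then show "(g' \<longlongrightarrow> g' z) (at z within interior K)"
    using assms(2) by (meson DiffD1 continuous_on_def interior_subset tendsto_within_subset)
qed

text \<open>Restricted to the interior because away from its closure the limit clause of
  \<open>partial_deriv_on\<close> is vacuous and holds for every \<open>g\<close>.\<close>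

lemma partial_deriv_on_unique:
  assumes "partial_deriv_on K v f g" "partial_deriv_on K v f' g'" "z \<in> interior K"
    and "\<And>z. z \<in> interior K \<Longrightarrow> f z = f' z"
  shows "g z = g' z"
  using partial_deriv_interior_cong[OF assms(2,3,4)] assms(1,3) unfolding partial_deriv_on_def
  by (metis DERIV_unique)

text \<open>Chooses the derivative fields hidden in \<open>Ck_on\<close> once and for all;
  \<open>D2 v w\<close> differentiates \<open>D v\<close> along \<open>w\<close>. Continuity on
  \<open>K\<close> gives \<open>isCont\<close> at interior points, where
  \<open>mixed_partials_commute\<close> applies.\<close>

lemma Ck_on_2_partials:
  assumes "Ck_on 2 K f"
  shows "\<exists>D D2. \<forall>v\<in>Basis. partial_deriv_on K v f (D v) \<and> continuous_on K (D v) \<and>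
      (\<forall>w\<in>Basis. partial_deriv_on K w (D v) (D2 v w) \<and> continuous_on K (D2 v w) \<and>
        (\<forall>z\<in>interior K. D2 v w z = D2 w v z))"
proof -
  have "\<forall>v\<in>Basis. \<exists>g. partial_deriv_on K v f g \<and> continuous_on K g \<and>
      (\<forall>w\<in>Basis. \<exists>h. partial_deriv_on K w g h \<and> continuous_on K h)"
    using assms by (simp add: numeral_2_eq_2)
  then obtain D where D: "\<forall>v\<in>Basis. partial_deriv_on K v f (D v) \<and> continuous_on K (D v) \<and>
      (\<forall>w\<in>Basis. \<exists>h. partial_deriv_on K w (D v) h \<and> continuous_on K h)"
    by metis
  then obtain D2 where D2: "\<forall>v\<in>Basis. \<forall>w\<in>Basis.
      partial_deriv_on K w (D v) (D2 v w) \<and> continuous_on K (D2 v w)"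
    by metis
  have "D2 v w z = D2 w v z" if "v \<in> Basis" "w \<in> Basis" "z \<in> interior K" for v w z
  proof (rule mixed_partials_commute[of "interior K" z f v "D v" w "D w"])
    show "isCont (D2 v w) z" "isCont (D2 w v) z"
      using D2 that continuous_on_interior by blast+
  qed (use that D D2 in \<open>auto simp: partial_deriv_on_def\<close>)
  with D D2 show ?thesis by blast
qed

section \<open>The linear system in coordinates\<close>

text \<open>Connects the named directions of the equations with the quantification over
  \<open>Basis\<close> in \<open>Ck_on\<close>.\<close>

lemma dir_in_Basis [simp]: "dir_t \<in> Basis" "dir_x k \<in> Basis"
  by (auto simp: dir_t_def dir_x_def Basis_prod_def axis_in_Basis_iff)

lemma velocity_of_nth: "velocity_of Z z $ 1 = Z z $ 3" "velocity_of Z z $ 2 = Z z $ 7"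
  "velocity_of Z z $ 3 = Z z $ 11"
  by (simp_all add: velocity_of_def)

text \<open>Bundles the four equations that one row of the matrices imposes.\<close>

definition gradient_on ::
    "spacetime set \<Rightarrow> (spacetime \<Rightarrow> real) \<Rightarrow> (spacetime \<Rightarrow> real) \<Rightarrow> (spacetime \<Rightarrow> real) \<Rightarrow>
     (spacetime \<Rightarrow> real) \<Rightarrow> (spacetime \<Rightarrow> real) \<Rightarrow> bool" where
  "gradient_on K f gt g1 g2 g3 \<longleftrightarrow> partial_deriv_on K dir_t f gt \<and>
     partial_deriv_on K (dir_x 1) f g1 \<and> partial_deriv_on K (dir_x 2) f g2 \<and>
     partial_deriv_on K (dir_x 3) f g3"

lemma alpha_inner:
  "alpha1 \<bullet> x = x $ 5 + x $ 10"
  "alpha2 \<mu> \<tau> \<bullet> x = \<tau> * x $ 13 - \<mu> * (x $ 18 + x $ 19 + x $ 20) + x $ 47 + x $ 48 + x $ 49"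
  "alpha3 \<mu> \<tau> \<bullet> x = \<tau> * x $ 14 - \<mu> * (x $ 28 + x $ 29 + x $ 30) + x $ 50 + x $ 51 + x $ 52"
  "alpha4 \<mu> \<tau> \<bullet> x = \<tau> * x $ 15 - \<mu> * (x $ 38 + x $ 39 + x $ 40) + x $ 53 + x $ 54 + x $ 55"
  by (simp_all only: alpha1_def alpha2_def alpha3_def alpha4_def inner_add_left inner_diff_left
      inner_scaleR_left e_inner)

text \<open>In terms of the flow, the rows treat in turn the x1-derivative of u1; the time
  derivatives of u1, u2, u3; the x2- and x3-derivatives of u1; u1; the space derivatives of u2; u2;
  those of u3; u3; and p.\<close>

lemma linear_system_iff:
  "linear_system K \<mu> \<tau> F Z \<longleftrightarrow>
     gradient_on K (\<lambda>z. - (alpha1 \<bullet> Z z))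
       (\<lambda>z. Z z $ 21) (\<lambda>z. Z z $ 18) (\<lambda>z. Z z $ 24) (\<lambda>z. Z z $ 25) \<and>
     gradient_on K (\<lambda>z. F z $ 1 - alpha2 \<mu> \<tau> \<bullet> Z z)
       (\<lambda>z. Z z $ 17) (\<lambda>z. Z z $ 21) (\<lambda>z. Z z $ 22) (\<lambda>z. Z z $ 23) \<and>
     gradient_on K (\<lambda>z. F z $ 2 - alpha3 \<mu> \<tau> \<bullet> Z z)
       (\<lambda>z. Z z $ 27) (\<lambda>z. Z z $ 31) (\<lambda>z. Z z $ 32) (\<lambda>z. Z z $ 33) \<and>
     gradient_on K (\<lambda>z. F z $ 3 - alpha4 \<mu> \<tau> \<bullet> Z z)
       (\<lambda>z. Z z $ 37) (\<lambda>z. Z z $ 41) (\<lambda>z. Z z $ 42) (\<lambda>z. Z z $ 43) \<and>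
     gradient_on K (\<lambda>z. Z z $ 1)
       (\<lambda>z. Z z $ 22) (\<lambda>z. Z z $ 24) (\<lambda>z. Z z $ 19) (\<lambda>z. Z z $ 26) \<and>
     gradient_on K (\<lambda>z. Z z $ 2)
       (\<lambda>z. Z z $ 23) (\<lambda>z. Z z $ 25) (\<lambda>z. Z z $ 26) (\<lambda>z. Z z $ 20) \<and>
     gradient_on K (\<lambda>z. Z z $ 3)
       (\<lambda>z. F z $ 1 - alpha2 \<mu> \<tau> \<bullet> Z z) (\<lambda>z. - (alpha1 \<bullet> Z z)) (\<lambda>z. Z z $ 1) (\<lambda>z. Z z $ 2) \<and>
     gradient_on K (\<lambda>z. Z z $ 4)
       (\<lambda>z. Z z $ 31) (\<lambda>z. Z z $ 28) (\<lambda>z. Z z $ 34) (\<lambda>z. Z z $ 35) \<and>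
     gradient_on K (\<lambda>z. Z z $ 5)
       (\<lambda>z. Z z $ 32) (\<lambda>z. Z z $ 34) (\<lambda>z. Z z $ 29) (\<lambda>z. Z z $ 36) \<and>
     gradient_on K (\<lambda>z. Z z $ 6)
       (\<lambda>z. Z z $ 33) (\<lambda>z. Z z $ 35) (\<lambda>z. Z z $ 36) (\<lambda>z. Z z $ 30) \<and>
     gradient_on K (\<lambda>z. Z z $ 7)
       (\<lambda>z. F z $ 2 - alpha3 \<mu> \<tau> \<bullet> Z z) (\<lambda>z. Z z $ 4) (\<lambda>z. Z z $ 5) (\<lambda>z. Z z $ 6) \<and>
     gradient_on K (\<lambda>z. Z z $ 8)
       (\<lambda>z. Z z $ 41) (\<lambda>z. Z z $ 38) (\<lambda>z. Z z $ 44) (\<lambda>z. Z z $ 45) \<and>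
     gradient_on K (\<lambda>z. Z z $ 9)
       (\<lambda>z. Z z $ 42) (\<lambda>z. Z z $ 44) (\<lambda>z. Z z $ 39) (\<lambda>z. Z z $ 46) \<and>
     gradient_on K (\<lambda>z. Z z $ 10)
       (\<lambda>z. Z z $ 43) (\<lambda>z. Z z $ 45) (\<lambda>z. Z z $ 46) (\<lambda>z. Z z $ 40) \<and>
     gradient_on K (\<lambda>z. Z z $ 11)
       (\<lambda>z. F z $ 3 - alpha4 \<mu> \<tau> \<bullet> Z z) (\<lambda>z. Z z $ 8) (\<lambda>z. Z z $ 9) (\<lambda>z. Z z $ 10) \<and>
     gradient_on K (\<lambda>z. Z z $ 16)
       (\<lambda>z. Z z $ 12) (\<lambda>z. Z z $ 13) (\<lambda>z. Z z $ 14) (\<lambda>z. Z z $ 15)"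
  unfolding linear_system_def Let_def forall_16 gradient_on_def vector_add_component
    matrix_vector_row vector_16[OF matH_def] vector_16[OF matH0_def] vector_16[OF matH1_def]
    vector_16[OF matH2_def] vector_16[OF matH3_def] vector_16[OF vec_h_def] vector_16[OF vec_h0_def]
    e_inner inner_minus_left add_0_right uminus_add_conv_diff
  by (rule refl)

section \<open>From the first order system to the Navier-Stokes equations\<close>

lemma navier_stokes_of_linear_system:
  assumes L: "linear_system K \<mu> \<tau> F Z" and Q: "quadratic_equations K Z"
  shows "navier_stokes K \<mu> \<tau> F (velocity_of Z) (pressure_of Z)"
  unfolding navier_stokes_def
proof (intro exI conjI)
  \<comment> \<open>The derivative fields are read off the rows for the velocity, its space
    derivatives and the pressure; \<open>vector\<close> serves as a case distinction on
    \<open>j\<close> and \<open>k\<close>.\<close>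
  let ?ut = "\<lambda>j z. (vector [F z $ 1 - alpha2 \<mu> \<tau> \<bullet> Z z, F z $ 2 - alpha3 \<mu> \<tau> \<bullet> Z z,
      F z $ 3 - alpha4 \<mu> \<tau> \<bullet> Z z] :: real^3) $ j"
  let ?ux = "\<lambda>j k z. (vector [vector [- (alpha1 \<bullet> Z z), Z z $ 1, Z z $ 2],
      vector [Z z $ 4, Z z $ 5, Z z $ 6], vector [Z z $ 8, Z z $ 9, Z z $ 10]] :: real^3^3) $ j $ k"
  let ?uxx = "\<lambda>j k z. (vector [vector [Z z $ 18, Z z $ 19, Z z $ 20],
      vector [Z z $ 28, Z z $ 29, Z z $ 30], vector [Z z $ 38, Z z $ 39, Z z $ 40]] :: real^3^3) $ j $ k"
  let ?px = "\<lambda>k z. (vector [Z z $ 13, Z z $ 14, Z z $ 15] :: real^3) $ k"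
  note G = L[unfolded linear_system_iff gradient_on_def]
  show "\<forall>j. partial_deriv_on K dir_t (\<lambda>z. velocity_of Z z $ j) (?ut j)"
    using G by (simp only: forall_3 velocity_of_nth vector_3)
  show "\<forall>j k. partial_deriv_on K (dir_x k) (\<lambda>z. velocity_of Z z $ j) (?ux j k)"
    using G by (simp only: forall_3 velocity_of_nth vector_3)
  show "\<forall>j k. partial_deriv_on K (dir_x k) (?ux j k) (?uxx j k)"
    using G by (simp only: forall_3 vector_3)
  show "\<forall>k. partial_deriv_on K (dir_x k) (pressure_of Z) (?px k)"
    using G by (simp only: forall_3 vector_3 pressure_of_def[abs_def] e_inner)
  show "\<forall>z\<in>K. (\<Sum>k\<in>UNIV. ?ux k k z) = 0"
    by (simp add: sum_3 alpha_inner)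
  show "\<forall>z\<in>K. \<forall>j. ?ut j z - \<mu> * (\<Sum>k\<in>UNIV. ?uxx j k z)
      + (\<Sum>k\<in>UNIV. velocity_of Z z $ k * ?ux j k z) + \<tau> * ?px j z = F z $ j"
    \<comment> \<open>The quadratic equations replace entries 47 to 55 by the convective products;
      everything except the force then cancels against the \<alpha>-term in
      \<open>?ut\<close>.\<close>
    using Q unfolding quadratic_equations_def
    by (simp add: sum_3 forall_3 velocity_of_nth alpha_inner)
qed

section \<open>From the Navier-Stokes equations to the first order system\<close>

lemma linear_system_of_navier_stokes:
  assumes F: "admissible_force K F" and flow: "admissible_flow K u p"
    and ns: "navier_stokes K \<mu> \<tau> F u p"
  shows "\<exists>Z. linear_system K \<mu> \<tau> F Z \<and> quadratic_equations K Z \<and>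
    u = velocity_of Z \<and> p = pressure_of Z"
proof -
  have "\<forall>j. \<exists>D D2. \<forall>v\<in>Basis. partial_deriv_on K v (\<lambda>z. u z $ j) (D v) \<and> continuous_on K (D v) \<and>
      (\<forall>w\<in>Basis. partial_deriv_on K w (D v) (D2 v w) \<and> continuous_on K (D2 v w) \<and>
        (\<forall>z\<in>interior K. D2 v w z = D2 w v z))"
    using flow unfolding admissible_flow_def by (blast intro: Ck_on_2_partials)
  then obtain D D2 where Du: "\<forall>j. \<forall>v\<in>Basis. partial_deriv_on K v (\<lambda>z. u z $ j) (D j v) \<and>
      continuous_on K (D j v) \<and>
      (\<forall>w\<in>Basis. partial_deriv_on K w (D j v) (D2 j v w) \<and> continuous_on K (D2 j v w) \<and>
        (\<forall>z\<in>interior K. D2 j v w z = D2 j w v z))"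
    by metis
  have D: "partial_deriv_on K v (\<lambda>z. u z $ j) (D j v)"
    and contD: "continuous_on K (D j v)" if "v \<in> Basis" for j v
    using Du that by blast+
  have D2: "partial_deriv_on K w (D j v) (D2 j v w)"
    and contD2: "continuous_on K (D2 j v w)" if "v \<in> Basis" "w \<in> Basis" for j v w
    using Du that by blast+
  have sym: "D2 j v w z = D2 j w v z"
    if "z \<in> interior K" "v \<in> Basis" "w \<in> Basis" for j v w z
    using Du that by blast
  obtain P where P: "\<And>v. v \<in> Basis \<Longrightarrow> partial_deriv_on K v p (P v)"
    and contP: "\<And>v. v \<in> Basis \<Longrightarrow> continuous_on K (P v)"
    using flow unfolding admissible_flow_def by simp metis
  have contF: "continuous_on K (\<lambda>z. F z $ j)" and contu: "continuous_on K (\<lambda>z. u z $ j)" for j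
    using F flow unfolding admissible_force_def admissible_flow_def
    by (simp_all add: numeral_2_eq_2)
  \<comment> \<open>At points of \<open>K\<close> outside the closure of its interior the derivative fields supplied by
    \<open>navier_stokes\<close> are arbitrary, so \<open>Z\<close> is built from the continuous ones given by
    regularity; the two agree on \<open>interior K\<close>. The entry 47 replaces \<open>\<partial>u\<^sub>1/\<partial>x\<^sub>1\<close> by
    \<open>- (\<partial>u\<^sub>2/\<partial>x\<^sub>2 + \<partial>u\<^sub>3/\<partial>x\<^sub>3)\<close>, which makes the quadratic equations hold on all of \<open>K\<close>.\<close>
  define Z :: "spacetime \<Rightarrow> real^55" where "Z z = vector
     [D 1 (dir_x 2) z, D 1 (dir_x 3) z, u z $ 1, D 2 (dir_x 1) z, D 2 (dir_x 2) z,
      D 2 (dir_x 3) z, u z $ 2, D 3 (dir_x 1) z, D 3 (dir_x 2) z, D 3 (dir_x 3) z, u z $ 3,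
      P dir_t z, P (dir_x 1) z, P (dir_x 2) z, P (dir_x 3) z, p z, D2 1 dir_t dir_t z,
      D2 1 (dir_x 1) (dir_x 1) z, D2 1 (dir_x 2) (dir_x 2) z, D2 1 (dir_x 3) (dir_x 3) z,
      D2 1 dir_t (dir_x 1) z, D2 1 dir_t (dir_x 2) z, D2 1 dir_t (dir_x 3) z,
      D2 1 (dir_x 1) (dir_x 2) z, D2 1 (dir_x 1) (dir_x 3) z, D2 1 (dir_x 2) (dir_x 3) z,
      D2 2 dir_t dir_t z, D2 2 (dir_x 1) (dir_x 1) z, D2 2 (dir_x 2) (dir_x 2) z,
      D2 2 (dir_x 3) (dir_x 3) z, D2 2 dir_t (dir_x 1) z, D2 2 dir_t (dir_x 2) z,
      D2 2 dir_t (dir_x 3) z, D2 2 (dir_x 1) (dir_x 2) z, D2 2 (dir_x 1) (dir_x 3) z,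
      D2 2 (dir_x 2) (dir_x 3) z, D2 3 dir_t dir_t z, D2 3 (dir_x 1) (dir_x 1) z,
      D2 3 (dir_x 2) (dir_x 2) z, D2 3 (dir_x 3) (dir_x 3) z, D2 3 dir_t (dir_x 1) z,
      D2 3 dir_t (dir_x 2) z, D2 3 dir_t (dir_x 3) z, D2 3 (dir_x 1) (dir_x 2) z,
      D2 3 (dir_x 1) (dir_x 3) z, D2 3 (dir_x 2) (dir_x 3) z,
      - (u z $ 1 * (D 2 (dir_x 2) z + D 3 (dir_x 3) z)), u z $ 2 * D 1 (dir_x 2) z,
      u z $ 3 * D 1 (dir_x 3) z, u z $ 1 * D 2 (dir_x 1) z, u z $ 2 * D 2 (dir_x 2) z,
      u z $ 3 * D 2 (dir_x 3) z, u z $ 1 * D 3 (dir_x 1) z, u z $ 2 * D 3 (dir_x 2) z,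
      u z $ 3 * D 3 (dir_x 3) z]" for z
  note Z = vector_55[OF Z_def]

  obtain ut ux uxx px where
    ut: "\<And>j. partial_deriv_on K dir_t (\<lambda>z. u z $ j) (ut j)"
    and ux: "\<And>j k. partial_deriv_on K (dir_x k) (\<lambda>z. u z $ j) (ux j k)"
    and uxx: "\<And>j k. partial_deriv_on K (dir_x k) (ux j k) (uxx j k)"
    and px: "\<And>k. partial_deriv_on K (dir_x k) p (px k)"
    and div: "\<And>z. z \<in> K \<Longrightarrow> (\<Sum>k\<in>UNIV. ux k k z) = 0"
    and mom: "\<And>z j. z \<in> K \<Longrightarrow> ut j z - \<mu> * (\<Sum>k\<in>UNIV. uxx j k z) +
        (\<Sum>k\<in>UNIV. u z $ k * ux j k z) + \<tau> * px j z = F z $ j"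
    using ns unfolding navier_stokes_def by blast
  have eqs: "ut j z = D j dir_t z" "ux j k z = D j (dir_x k) z" "px k z = P (dir_x k) z"
    if "z \<in> interior K" for j k z
    using partial_deriv_on_unique[OF ut D that] partial_deriv_on_unique[OF ux D that]
      partial_deriv_on_unique[OF px P that] by simp_all
  \<comment> \<open>Here the differentiated functions \<open>ux j k\<close> and
    \<open>D j (dir_x k)\<close> are themselves known to agree only on the interior, by
    \<open>eqs(2)\<close>.\<close>
  have eq2: "uxx j k z = D2 j (dir_x k) (dir_x k) z" if "z \<in> interior K" for j k z
    using partial_deriv_on_unique[OF uxx D2 that] eqs(2) by simp
  have inc: "- (alpha1 \<bullet> Z z) = D 1 (dir_x 1) z" if z: "z \<in> interior K" for z
    using div[of z] z interior_subset[of K] eqs(2)[OF z] by (auto simp: sum_3 alpha_inner Z)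
  have vel: "F z $ 1 - alpha2 \<mu> \<tau> \<bullet> Z z = D 1 dir_t z"
    "F z $ 2 - alpha3 \<mu> \<tau> \<bullet> Z z = D 2 dir_t z"
    "F z $ 3 - alpha4 \<mu> \<tau> \<bullet> Z z = D 3 dir_t z" if z: "z \<in> interior K" for z
  proof -
    have "z \<in> K" using z interior_subset by blast
    note mom[OF this, unfolded sum_3 eqs[OF z] eq2[OF z], symmetric]
    \<comment> \<open>Entry 47 is written without the x1-derivative of u1, so incompressibility must
      restore the product that occurs in the momentum equation.\<close>
    moreover have "u z $ 1 * D 1 (dir_x 1) z = - (u z $ 1 * (D 2 (dir_x 2) z + D 3 (dir_x 3) z))"
      unfolding inc[OF z, symmetric] by (simp only: alpha_inner Z mult_minus_right)
    ultimately show "F z $ 1 - alpha2 \<mu> \<tau> \<bullet> Z z = D 1 dir_t z"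
      "F z $ 2 - alpha3 \<mu> \<tau> \<bullet> Z z = D 2 dir_t z" "F z $ 3 - alpha4 \<mu> \<tau> \<bullet> Z z = D 3 dir_t z"
      by (simp_all add: alpha_inner Z)
  qed
  \<comment> \<open>These expressions occur as derivative fields in the rows for the velocity, so
    continuity on all of \<open>K\<close> is what \<open>partial_deriv_onI\<close> asks of
    them.\<close>
  have cont: "continuous_on K (\<lambda>z. - (alpha1 \<bullet> Z z))"
    "continuous_on K (\<lambda>z. F z $ 1 - alpha2 \<mu> \<tau> \<bullet> Z z)"
    "continuous_on K (\<lambda>z. F z $ 2 - alpha3 \<mu> \<tau> \<bullet> Z z)"
    "continuous_on K (\<lambda>z. F z $ 3 - alpha4 \<mu> \<tau> \<bullet> Z z)"
    unfolding alpha_inner Z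
    by (intro continuous_intros contF contu contD contD2 contP dir_in_Basis)+

  \<comment> \<open>\<open>partial_deriv_onI\<close> for all four directions at once: agreement on
    the interior plus continuity of the new fields transfers a gradient.\<close>
  have grad: "gradient_on K f gt g1 g2 g3"
    if "gradient_on K f' gt' g1' g2' g3'"
      "continuous_on K gt" "continuous_on K g1" "continuous_on K g2" "continuous_on K g3"
      "\<And>z. z \<in> interior K \<Longrightarrow> f z = f' z \<and> gt z = gt' z \<and>
        g1 z = g1' z \<and> g2 z = g2' z \<and> g3 z = g3' z"
    for f gt g1 g2 g3 f' gt' g1' g2' g3'
    using that unfolding gradient_on_def by (blast intro: partial_deriv_onI)
  have gradD: "gradient_on K (D j v)
      (D2 j v dir_t) (D2 j v (dir_x 1)) (D2 j v (dir_x 2)) (D2 j v (dir_x 3))"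
    if "v \<in> Basis" for j v
    unfolding gradient_on_def using D2 that by simp
  have gradu: "gradient_on K (\<lambda>z. u z $ j)
      (D j dir_t) (D j (dir_x 1)) (D j (dir_x 2)) (D j (dir_x 3))" for j
    unfolding gradient_on_def using D by simp
  have gradp: "gradient_on K p (P dir_t) (P (dir_x 1)) (P (dir_x 2)) (P (dir_x 3))"
    unfolding gradient_on_def using P by simp
  note conts = cont contu contD[OF dir_in_Basis(1)] contD[OF dir_in_Basis(2)]
    contD2[OF dir_in_Basis(1) dir_in_Basis(1)] contD2[OF dir_in_Basis(1) dir_in_Basis(2)]
    contD2[OF dir_in_Basis(2) dir_in_Basis(2)] contP[OF dir_in_Basis(1)] contP[OF dir_in_Basis(2)]
  \<comment> \<open>The first rule moves \<open>dir_t\<close> to the front, as in the entries of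
    \<open>Z\<close>; the second is permutative and is applied by ordered rewriting.\<close>
  note syms = sym[OF _ dir_in_Basis(2) dir_in_Basis(1)] sym[OF _ dir_in_Basis(2) dir_in_Basis(2)]
  have "linear_system K \<mu> \<tau> F Z"
    unfolding linear_system_iff Z
  \<comment> \<open>Each case names the derivative, velocity component or pressure that its row
    stands for. The \<alpha>-products stay folded so that \<open>inc\<close>, \<open>vel\<close> and
    \<open>cont\<close> match.\<close>
  proof (intro conjI, goal_cases)
    case 1 show ?case
      by (rule grad[OF gradD[of "dir_x 1" 1]]) (simp_all add: conts inc vel syms)
  next
    case 2 show ?case
      by (rule grad[OF gradD[of dir_t 1]]) (simp_all add: conts inc vel syms)
  next
    case 3 show ?case
      by (rule grad[OF gradD[of dir_t 2]]) (simp_all add: conts inc vel syms)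
  next
    case 4 show ?case
      by (rule grad[OF gradD[of dir_t 3]]) (simp_all add: conts inc vel syms)
  next
    case 5 show ?case
      by (rule grad[OF gradD[of "dir_x 2" 1]]) (simp_all add: conts inc vel syms)
  next
    case 6 show ?case
      by (rule grad[OF gradD[of "dir_x 3" 1]]) (simp_all add: conts inc vel syms)
  next
    case 7 show ?case
      by (rule grad[OF gradu[of 1]]) (simp_all add: conts inc vel syms)
  next
    case 8 show ?case
      by (rule grad[OF gradD[of "dir_x 1" 2]]) (simp_all add: conts inc vel syms)
  next
    case 9 show ?case
      by (rule grad[OF gradD[of "dir_x 2" 2]]) (simp_all add: conts inc vel syms)
  next
    case 10 show ?case
      by (rule grad[OF gradD[of "dir_x 3" 2]]) (simp_all add: conts inc vel syms)
  next
    case 11 show ?case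
      by (rule grad[OF gradu[of 2]]) (simp_all add: conts inc vel syms)
  next
    case 12 show ?case
      by (rule grad[OF gradD[of "dir_x 1" 3]]) (simp_all add: conts inc vel syms)
  next
    case 13 show ?case
      by (rule grad[OF gradD[of "dir_x 2" 3]]) (simp_all add: conts inc vel syms)
  next
    case 14 show ?case
      by (rule grad[OF gradD[of "dir_x 3" 3]]) (simp_all add: conts inc vel syms)
  next
    case 15 show ?case
      by (rule grad[OF gradu[of 3]]) (simp_all add: conts inc vel syms)
  next
    case 16 show ?case
      by (rule grad[OF gradp]) (simp_all add: conts inc vel syms)
  qed
  moreover have "quadratic_equations K Z"
    unfolding quadratic_equations_def by (simp add: alpha_inner Z algebra_simps)
  moreover have "u = velocity_of Z"
    by (simp add: fun_eq_iff vec_eq_iff forall_3 velocity_of_nth Z)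
  moreover have "p = pressure_of Z"
    by (simp add: fun_eq_iff pressure_of_def Z)
  ultimately show ?thesis by blast
qed

theorem theorem2p2:
  fixes \<mu> \<tau> T :: real
    and K1 :: "(real^3) set"
    and K :: "spacetime set"
    and F :: "spacetime \<Rightarrow> real^3"
  assumes "\<mu> > 0" and "\<tau> > 0" and "T > 0"
    and "bounded K1" and "closed K1" and "exterior_ball_condition K1"
    and "K = {0..T} \<times> K1"
    and "admissible_force K F"
  shows "(\<forall>u p. admissible_flow K u p \<and> navier_stokes K \<mu> \<tau> F u p \<longrightarrow>
            (\<exists>Z. linear_system K \<mu> \<tau> F Z \<and> quadratic_equations K Z \<and>
                 u = velocity_of Z \<and> p = pressure_of Z)) \<and>
         (\<forall>Z. linear_system K \<mu> \<tau> F Z \<and> quadratic_equations K Z \<and>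
              admissible_flow K (velocity_of Z) (pressure_of Z) \<longrightarrow>
              navier_stokes K \<mu> \<tau> F (velocity_of Z) (pressure_of Z))"
  using linear_system_of_navier_stokes[OF assms(8)] navier_stokes_of_linear_system by blast

end
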